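(* Fix a positive integer $k$ and a real number $x\ge 0$. For each positive integer $m$, let $f:[m]^k\to[m]$ be chosen uniformly at random, let $(X_1,\ldots,X_k)$ be uniform on $[m]^k$ and independent of $f$, let $X_{n+k}=f(X_n,\ldots,X_{n+k-1})$ for $n\ge1$, and let $W_n=(X_n,\ldots,X_{n+k-1})$ for $n \geq 1$. Let $\tau$ be the least integer such that $W_{\tau-k+1}=W_{\mu-k+1}$ for some integer $\mu$ with $k\le\mu<\tau$. Then, as $m\to\infty$, $$\mathbb{P}\left(\frac{\tau^2}{2m^k}\ge x\right)\to \exp(-x).$$
   Context: $[m]:=\{1,\ldots,m\}$. The function $f$ is uniform among the $m^{(m^k)}$ functions $[m]^k\to[m]$. *)

theory Defs
  imports "HOL-Probability.Probability"
begin

definition tuples :: "nat \<Rightarrow> nat \<Rightarrow> nat list set" where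
  "tuples k m = {w. length w = k \<and> set w \<subseteq> {1..m}}"

text \<open>
  The functions from \<open>[m]\<close>-tuples of length \<open>k\<close> to \<open>[m]\<close>. They are extensional (\<open>undefined\<close>
  off \<open>tuples k m\<close>), so that each mathematical function is counted exactly once.
\<close>
definition feedback_funs :: "nat \<Rightarrow> nat \<Rightarrow> (nat list \<Rightarrow> nat) set" where
  "feedback_funs k m = tuples k m \<rightarrow>\<^sub>E {1..m}"

text \<open>
  The sequence is indexed from 1: \<open>w\<close> is the list of its terms 1 to \<open>k\<close>.
  The value at index 0 has no meaning and is never used.
\<close>
function X_seq :: "nat \<Rightarrow> (nat list \<Rightarrow> nat) \<Rightarrow> nat list \<Rightarrow> nat \<Rightarrow> nat" where
  "X_seq k f w n = (if n \<le> k then w ! (n - 1) else f (map (X_seq k f w) [n - k..<n]))"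
  by pat_completeness auto
termination
  by (relation "Wellfounded.measure (\<lambda>(k, f, w, n). n)") auto

declare X_seq.simps [simp del]

definition window :: "nat \<Rightarrow> (nat list \<Rightarrow> nat) \<Rightarrow> nat list \<Rightarrow> nat \<Rightarrow> nat list" where
  "window k f w n = map (X_seq k f w) [n..<n + k]"

lemma X_seq_initial: "n \<in> {1..k} \<Longrightarrow> X_seq k f w n = w ! (n - 1)"
  by (subst X_seq.simps) simp

lemma X_seq_recurrence: "n \<ge> 1 \<Longrightarrow> X_seq k f w (n + k) = f (window k f w n)"
  by (subst X_seq.simps) (simp add: window_def)

definition tau :: "nat \<Rightarrow> (nat list \<Rightarrow> nat) \<Rightarrow> nat list \<Rightarrow> nat" where
  "tau k f w = (LEAST t. \<exists>\<mu>. k \<le> \<mu> \<and> \<mu> < t \<and>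
     window k f w (t - k + 1) = window k f w (\<mu> - k + 1))"

lemma window_in_tuples:
  assumes f: "f \<in> feedback_funs k m" and w: "w \<in> tuples k m" and "n \<ge> 1"
  shows "window k f w n \<in> tuples k m"
proof -
  have X: "X_seq k f w i \<in> {1..m}" if "i \<ge> 1" for i
    using that
  proof (induction i rule: less_induct)
    case (less i)
    show ?case
    proof (cases "i \<le> k")
      case True
      with less.prems w have "w ! (i - 1) \<in> set w"
        by (auto simp: tuples_def)
      with w have "w ! (i - 1) \<in> {1..m}" by (auto simp: tuples_def)
      with True less.prems show ?thesis by (simp add: X_seq_initial)
    next
      case False
      with less.IH have "map (X_seq k f w) [i - k..<i] \<in> tuples k m"
        by (auto simp: tuples_def)
      with f have "f (map (X_seq k f w) [i - k..<i]) \<in> {1..m}"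
        unfolding feedback_funs_def by (rule PiE_mem)
      with False show ?thesis by (subst X_seq.simps) simp
    qed
  qed
  with \<open>n \<ge> 1\<close> show ?thesis
    by (fastforce simp: tuples_def window_def)
qed

text \<open>The minimum defining \<open>tau\<close> is attained.\<close>
lemma tau_exists:
  assumes "f \<in> feedback_funs k m" and "w \<in> tuples k m"
  shows "\<exists>t \<mu>. k \<le> \<mu> \<and> \<mu> < t \<and>
    window k f w (t - k + 1) = window k f w (\<mu> - k + 1)"
proof -
  have "finite (tuples k m)"
    using finite_lists_length_eq[of "{1..m}" k] by (simp add: tuples_def conj_commute)
  moreover have "(\<lambda>t. window k f w (t - k + 1)) ` {k..} \<subseteq> tuples k m"
    using window_in_tuples[OF assms] by auto
  ultimately have "finite ((\<lambda>t. window k f w (t - k + 1)) ` {k..})"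
    by (rule rev_finite_subset)
  then have "\<not> inj_on (\<lambda>t. window k f w (t - k + 1)) {k..}"
    using finite_imageD infinite_Ici by blast
  then obtain a b where "k \<le> a" "k \<le> b" "a \<noteq> b"
    "window k f w (a - k + 1) = window k f w (b - k + 1)"
    unfolding inj_on_def by auto
  then show ?thesis by (metis linorder_neqE_nat)
qed

text \<open>
  The joint law of \<open>f\<close> and the initial terms: both uniform, and independent since
  \<^const>\<open>pair_pmf\<close> is the product law. Meaningful for \<open>m \<ge> 1\<close>.
\<close>
definition model :: "nat \<Rightarrow> nat \<Rightarrow> ((nat list \<Rightarrow> nat) \<times> nat list) pmf" where
  "model k m = pair_pmf (pmf_of_set (feedback_funs k m)) (pmf_of_set (tuples k m))"

end

theory Submission
  imports Defs
begin

text \<open>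
  This is a birthday problem. As long as the windows of the sequence are distinct, each new letter is
  a value of \<open>f\<close> at a fresh argument; so the sequence behaves like independent uniform letters until
  the first repeat, and \<open>\<tau> \<ge> N\<close> has the probability that the first \<open>N - k\<close> windows of
  a uniformly random word are distinct (\<open>prob_le_tau\<close>). Two windows of a random word agree with
  probability \<open>1 / M\<close>, where \<open>M = m ^ k\<close>, and if all these coincidences were independent, \<open>J\<close> windows
  would be distinct with probability about \<open>exp (- J\<^sup>2 / (2 * M))\<close>. The time
  \<open>N = sqrt (2 * x * M)\<close> gives \<open>exp (- x)\<close>.

  What has to be shown is that the overlaps of the windows do not spoil this. Let \<open>F J\<close> be the
  probability that the first \<open>J\<close> windows are distinct. Then \<open>F j - F (j + 1)\<close> is the probability that
  the window at position \<open>j\<close> causes the first repeat. The windows that end before position \<open>j\<close> do not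
  meet it, and with these \<open>j + 1 - k\<close> windows in place of the first \<open>j\<close> the probability is
  exactly \<open>(j + 1 - k) / M * F (j + 1 - k)\<close> (\<open>freq_new_window_repeats_old\<close>). The replacement is
  wrong only if the window repeats one that is less than \<open>k\<close> steps away, which has probability at
  most \<open>k / M\<close>, or if two repeats occur within \<open>k\<close> steps. Two repeats usually impose \<open>2 * k\<close>
  independent equations on the letters, which makes them rare enough; the exceptional pairs, above all
  those where one repeated block longer than \<open>k\<close> produces both repeats, still impose \<open>k + 1\<close>
  equations and are fewer by an order of magnitude (\<open>freq_two_repeats_sum_le\<close>). A single lemma
  computes all these probabilities: if each of a set of letters is required to equal some earlier
  letter, every such requirement costs a factor \<open>m\<close> (\<open>card_tied_words\<close>).

  Thus \<open>F (j + 1)\<close> is \<open>exp (- j / M) * F j\<close> up to errors whose sum over \<open>j < J\<close> tends to \<open>0\<close> when \<open>J\<close>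
  is of order \<open>sqrt M\<close> (\<open>freq_distinct_windows_step\<close>, \<open>freq_distinct_windows_approx\<close>).
\<close>

section \<open>Words with tied letters\<close>

lemma finite_tuples: "finite (tuples n m)"
  using finite_lists_length_eq[of "{1..m}" n] by (simp add: tuples_def conj_commute)

lemma card_tuples: "card (tuples n m) = m ^ n"
  using card_lists_length_eq[of "{1..m}" n] by (simp add: tuples_def conj_commute)

lemma length_tuples: "x \<in> tuples n m \<Longrightarrow> length x = n"
  by (simp add: tuples_def)

lemma nth_tuples: "x \<in> tuples n m \<Longrightarrow> i < n \<Longrightarrow> x ! i \<in> {1..m}"
  unfolding tuples_def using nth_mem by blast

lemma tuples_Suc_iff: "x \<in> tuples (Suc n) m \<longleftrightarrow> (\<exists>y a. x = y @ [a] \<and> y \<in> tuples n m \<and> a \<in> {1..m})"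
proof
  assume x: "x \<in> tuples (Suc n) m"
  then have "x \<noteq> []" by (auto simp: tuples_def)
  then obtain y a where "x = y @ [a]" by (metis append_butlast_last_id)
  with x show "\<exists>y a. x = y @ [a] \<and> y \<in> tuples n m \<and> a \<in> {1..m}"
    by (auto simp: tuples_def)
qed (auto simp: tuples_def)

text \<open>
  Reading the word from left to right, each letter at a position in \<open>S\<close> is forced by an earlier
  letter, whatever that earlier letter is; so each such position costs exactly one factor \<open>m\<close>,
  even if the positions \<open>g b\<close> lie in \<open>S\<close> themselves. This is what makes overlapping windows
  harmless. The tied positions are beyond the first \<open>r\<close> letters, so any condition on these
  letters may be imposed as well.
\<close>
lemma card_tied_words:
  assumes "r \<le> n" "S \<subseteq> {r..<n}" "\<And>b. b \<in> S \<Longrightarrow> g b < b"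
  shows "card {x \<in> tuples n m. Q (take r x) \<and> (\<forall>b\<in>S. x ! b = x ! g b)} * m ^ card S
       = card {x \<in> tuples n m. Q (take r x)}"
  using assms
proof (induction n arbitrary: S rule: dec_induct)
  case base
  then show ?case by simp
next
  case (step n)
  define E where "E T = {x \<in> tuples n m. Q (take r x) \<and> (\<forall>b\<in>T. x ! b = x ! g b)}" for T
  define S' where "S' = S - {n}"
  have S': "S' \<subseteq> {r..<n}" using step.prems unfolding S'_def by fastforce
  have finS: "finite S" using step.prems finite_subset by blast
  have IH: "card (E S') * m ^ card S' = card (E {})"
    using step.IH[OF S'] step.prems(2) by (simp add: E_def S'_def)
  have tied: "(\<forall>b\<in>S'. (y @ [a]) ! b = (y @ [a]) ! g b) \<longleftrightarrow> (\<forall>b\<in>S'. y ! b = y ! g b)"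
    if "y \<in> tuples n m" for y a
  proof (rule ball_cong[OF refl])
    fix b assume "b \<in> S'"
    then have "b < n" "g b < b" using S' step.prems(2) unfolding S'_def by auto
    then show "((y @ [a]) ! b = (y @ [a]) ! g b) = (y ! b = y ! g b)"
      using length_tuples[OF that] by (simp add: nth_append)
  qed
  have pre: "take r (y @ [a]) = take r y" if "y \<in> tuples n m" for y a
    using length_tuples[OF that] step.hyps by simp
  have free: "card ((\<lambda>(y, a). y @ [a]) ` (E T \<times> {1..m})) = card (E T) * m" for T
    by (subst card_image) (auto simp: inj_on_def card_cartesian_product)
  have all: "{x \<in> tuples (Suc n) m. Q (take r x)} = (\<lambda>(y, a). y @ [a]) ` (E {} \<times> {1..m})"
    by (auto simp: tuples_Suc_iff E_def pre image_iff simp del: take_append)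
  show ?case
  proof (cases "n \<in> S")
    case False
    then have "S' = S" by (simp add: S'_def)
    then have eq: "{x \<in> tuples (Suc n) m. Q (take r x) \<and> (\<forall>b\<in>S. x ! b = x ! g b)}
      = (\<lambda>(y, a). y @ [a]) ` (E S' \<times> {1..m})"
      using tied by (auto simp: tuples_Suc_iff E_def pre image_iff simp del: take_append)
    show ?thesis using IH \<open>S' = S\<close> unfolding eq all free by (simp add: mult_ac)
  next
    case True
    then have g: "g n < n" using step.prems by blast
    have S: "S = insert n S'" using True by (auto simp: S'_def)
    have last: "(y @ [a]) ! n = (y @ [a]) ! g n \<longleftrightarrow> a = y ! g n" if "y \<in> tuples n m" for y a
      using length_tuples[OF that] g by (auto simp: nth_append)
    have "{x \<in> tuples (Suc n) m. Q (take r x) \<and> (\<forall>b\<in>S. x ! b = x ! g b)}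
      = (\<lambda>y. y @ [y ! g n]) ` E S'"
    proof (intro set_eqI iffI)
      fix x assume "x \<in> {x \<in> tuples (Suc n) m. Q (take r x) \<and> (\<forall>b\<in>S. x ! b = x ! g b)}"
      then obtain y a where x: "x = y @ [a]" and y: "y \<in> tuples n m" and "Q (take r (y @ [a]))"
        "\<forall>b\<in>S'. (y @ [a]) ! b = (y @ [a]) ! g b" "(y @ [a]) ! n = (y @ [a]) ! g n"
        unfolding tuples_Suc_iff S by blast
      then have "y \<in> E S'" "a = y ! g n"
        unfolding E_def pre[OF y] tied[OF y] last[OF y] by simp_all
      then show "x \<in> (\<lambda>y. y @ [y ! g n]) ` E S'" using x by blast
    next
      fix x assume "x \<in> (\<lambda>y. y @ [y ! g n]) ` E S'"
      then obtain y where x: "x = y @ [y ! g n]" and y: "y \<in> tuples n m" and "y \<in> E S'"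
        by (auto simp: E_def)
      have "x \<in> tuples (Suc n) m"
        unfolding x tuples_Suc_iff using y nth_tuples[OF y g] by blast
      moreover have "Q (take r x)" "\<forall>b\<in>S'. x ! b = x ! g b"
        using \<open>y \<in> E S'\<close> unfolding x pre[OF y] tied[OF y] by (auto simp: E_def)
      moreover have "x ! n = x ! g n"
        unfolding x last[OF y] by (rule refl)
      ultimately show "x \<in> {x \<in> tuples (Suc n) m. Q (take r x) \<and> (\<forall>b\<in>S. x ! b = x ! g b)}"
        unfolding S by blast
    qed
    moreover have "card ((\<lambda>y. y @ [y ! g n]) ` E S') = card (E S')"
      by (rule card_image) (auto simp: inj_on_def)
    moreover have "card S = Suc (card S')"
      using finS True unfolding S'_def by (rule card_Suc_Diff1[symmetric])
    ultimately show ?thesis using IH unfolding all free by (simp add: mult_ac)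
  qed
qed

text \<open>
  The probability of an event for a uniformly random word, kept as a proportion because all the
  estimates below come from counting words.
\<close>
definition freq :: "nat \<Rightarrow> nat \<Rightarrow> (nat list \<Rightarrow> bool) \<Rightarrow> real" where
  "freq n m Q = card {x \<in> tuples n m. Q x} / real m ^ n"

lemma freq_nonneg: "0 \<le> freq n m Q"
  by (simp add: freq_def)

lemma freq_True: "m \<ge> 1 \<Longrightarrow> freq n m (\<lambda>x. True) = 1"
  by (simp add: freq_def card_tuples)

lemma freq_mono: "(\<And>x. x \<in> tuples n m \<Longrightarrow> Q x \<Longrightarrow> Q' x) \<Longrightarrow> freq n m Q \<le> freq n m Q'"
  unfolding freq_def
  by (intro divide_right_mono of_nat_mono card_mono) (auto simp: finite_tuples)

lemma freq_cong: "(\<And>x. x \<in> tuples n m \<Longrightarrow> Q x \<longleftrightarrow> Q' x) \<Longrightarrow> freq n m Q = freq n m Q'"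
  by (intro antisym freq_mono) auto

lemma freq_le_1: "m \<ge> 1 \<Longrightarrow> freq n m Q \<le> 1"
  using freq_mono[of n m Q "\<lambda>x. True"] by (simp add: freq_True)

lemma freq_split: "freq n m Q = freq n m (\<lambda>x. Q x \<and> P x) + freq n m (\<lambda>x. Q x \<and> \<not> P x)"
proof -
  have "card {x \<in> tuples n m. Q x}
    = card ({x \<in> tuples n m. Q x \<and> P x} \<union> {x \<in> tuples n m. Q x \<and> \<not> P x})"
    by (intro arg_cong[of _ _ card]) auto
  also have "\<dots> = card {x \<in> tuples n m. Q x \<and> P x} + card {x \<in> tuples n m. Q x \<and> \<not> P x}"
    by (rule card_Un_disjoint) (auto simp: finite_tuples)
  finally show ?thesis by (simp add: freq_def add_divide_distrib)
qed

lemma freq_diff_le: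
  "freq n m Q \<le> freq n m Q' + freq n m (\<lambda>x. Q x \<and> \<not> Q' x)"
  using freq_split[of n m Q Q'] freq_mono[of n m "\<lambda>x. Q x \<and> Q' x" Q'] by auto

lemma freq_Bex_le:
  assumes "finite I"
  shows "freq n m (\<lambda>x. \<exists>i\<in>I. Q i x) \<le> (\<Sum>i\<in>I. freq n m (Q i))"
proof -
  have "card {x \<in> tuples n m. \<exists>i\<in>I. Q i x} = card (\<Union>i\<in>I. {x \<in> tuples n m. Q i x})"
    by (intro arg_cong[of _ _ card]) auto
  also have "\<dots> \<le> (\<Sum>i\<in>I. card {x \<in> tuples n m. Q i x})"
    using assms by (rule card_UN_le)
  finally have "real (card {x \<in> tuples n m. \<exists>i\<in>I. Q i x}) \<le> (\<Sum>i\<in>I. real (card {x \<in> tuples n m. Q i x}))"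
    by (simp flip: of_nat_sum)
  then show ?thesis
    by (simp add: freq_def divide_right_mono flip: sum_divide_distrib)
qed

lemma freq_Bex_eq:
  assumes "finite I" "\<And>i j x. x \<in> tuples n m \<Longrightarrow> i \<in> I \<Longrightarrow> j \<in> I \<Longrightarrow> Q i x \<Longrightarrow> Q j x \<Longrightarrow> i = j"
  shows "freq n m (\<lambda>x. \<exists>i\<in>I. Q i x) = (\<Sum>i\<in>I. freq n m (Q i))"
proof -
  have "card {x \<in> tuples n m. \<exists>i\<in>I. Q i x} = card (\<Union>i\<in>I. {x \<in> tuples n m. Q i x})"
    by (intro arg_cong[of _ _ card]) auto
  also have "\<dots> = (\<Sum>i\<in>I. card {x \<in> tuples n m. Q i x})"
    using assms by (intro card_UN_disjoint) (auto simp: finite_tuples)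
  finally show ?thesis
    by (simp add: freq_def flip: sum_divide_distrib)
qed

lemma freq_prefix_and_tied_letters:
  assumes "m \<ge> 1" "r \<le> n" "S \<subseteq> {r..<n}" "\<And>b. b \<in> S \<Longrightarrow> g b < b"
  shows "freq n m (\<lambda>x. Q (take r x) \<and> (\<forall>b\<in>S. x ! b = x ! g b))
    = freq n m (\<lambda>x. Q (take r x)) / real m ^ card S"
proof -
  have "real (card {x \<in> tuples n m. Q (take r x) \<and> (\<forall>b\<in>S. x ! b = x ! g b)}) * m ^ card S
      = real (card {x \<in> tuples n m. Q (take r x)})"
    using arg_cong[OF card_tied_words[OF assms(2-4), of m Q], of real] by simp
  with \<open>m \<ge> 1\<close> show ?thesis by (simp add: freq_def field_simps)
qed

lemma freq_tied_letters:
  assumes "m \<ge> 1" "S \<subseteq> {..<n}" "\<And>b. b \<in> S \<Longrightarrow> g b < b"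
  shows "freq n m (\<lambda>x. \<forall>b\<in>S. x ! b = x ! g b) = 1 / real m ^ card S"
  using freq_prefix_and_tied_letters[of m 0 n S g "\<lambda>_. True"] assms by (simp add: freq_True lessThan_atLeast0)

section \<open>Repeated windows in a random word\<close>

text \<open>
  Windows are numbered by their starting positions, counted from \<open>0\<close> as list positions are.
\<close>
definition same_window :: "nat \<Rightarrow> nat \<Rightarrow> nat \<Rightarrow> nat list \<Rightarrow> bool" where
  "same_window k i j x \<longleftrightarrow> (\<forall>t<k. x ! (i + t) = x ! (j + t))"

definition distinct_windows :: "nat \<Rightarrow> nat \<Rightarrow> nat list \<Rightarrow> bool" where
  "distinct_windows k J x \<longleftrightarrow> (\<forall>j<J. \<forall>i<j. \<not> same_window k i j x)"

text \<open>
  A repeated window, even one that overlaps its earlier copy, ties each of its \<open>k\<close> letters to an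
  earlier letter.
\<close>
lemma same_window_tied:
  assumes "i < j"
  shows "same_window k i j x \<longleftrightarrow> (\<forall>b\<in>{j..<j + k}. x ! b = x ! (b - (j - i)))"
proof
  assume L: "same_window k i j x"
  show "\<forall>b\<in>{j..<j + k}. x ! b = x ! (b - (j - i))"
  proof
    fix b assume b: "b \<in> {j..<j + k}"
    then have "b - j < k" by auto
    then have "x ! (i + (b - j)) = x ! (j + (b - j))"
      using L unfolding same_window_def by blast
    moreover have "i + (b - j) = b - (j - i)" "j + (b - j) = b" using b assms by auto
    ultimately show "x ! b = x ! (b - (j - i))" by metis
  qed
next
  assume R: "\<forall>b\<in>{j..<j + k}. x ! b = x ! (b - (j - i))"
  show "same_window k i j x" unfolding same_window_def
  proof (intro allI impI)
    fix t assume "t < k"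
    then have "x ! (j + t) = x ! (j + t - (j - i))" using R by auto
    moreover have "j + t - (j - i) = i + t" using assms by auto
    ultimately show "x ! (i + t) = x ! (j + t)" by metis
  qed
qed

lemma freq_same_window:
  assumes "m \<ge> 1" "i < j" "j + k \<le> n"
  shows "freq n m (same_window k i j) = 1 / real m ^ k"
proof -
  have "freq n m (same_window k i j) = freq n m (\<lambda>x. \<forall>b\<in>{j..<j + k}. x ! b = x ! (b - (j - i)))"
    unfolding same_window_tied[OF assms(2), abs_def] ..
  also have "\<dots> = 1 / real m ^ card {j..<j + k}"
    using assms by (intro freq_tied_letters) auto
  finally show ?thesis by simp
qed

text \<open>
  The first \<open>j + 1 - k\<close> windows are those that lie within the first \<open>j\<close> letters.
\<close>
lemma distinct_windows_take:
  assumes "x \<in> tuples n m" "j \<le> n"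
  shows "distinct_windows k (j + 1 - k) (take j x) \<longleftrightarrow> distinct_windows k (j + 1 - k) x"
proof -
  have "same_window k a b (take j x) \<longleftrightarrow> same_window k a b x" if "a < b" "b < j + 1 - k" for a b
    using that assms(2) unfolding same_window_def by (intro all_cong) simp
  then show ?thesis unfolding distinct_windows_def by blast
qed

text \<open>
  The window at \<open>j\<close> shares no letter with the \<open>h\<close> windows that end before \<open>j\<close>, hence it is uniform
  given these windows; if they are distinct, it equals one of them with probability exactly
  \<open>h / m ^ k\<close>.
\<close>
lemma freq_new_window_repeats_old:
  assumes "m \<ge> 1" "k \<ge> 1" "j + k \<le> n"
  defines "h \<equiv> j + 1 - k"
  shows "freq n m (\<lambda>x. distinct_windows k h x \<and> (\<exists>i<h. same_window k i j x))
       = real h / real m ^ k * freq n m (distinct_windows k h)"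
proof -
  have one: "freq n m (\<lambda>x. distinct_windows k h x \<and> same_window k i j x)
      = freq n m (distinct_windows k h) / real m ^ k" if "i < h" for i
  proof -
    have ij: "i < j" using that \<open>k \<ge> 1\<close> by (auto simp: h_def)
    have "freq n m (\<lambda>x. distinct_windows k h x \<and> same_window k i j x)
      = freq n m (\<lambda>x. distinct_windows k h (take j x) \<and> (\<forall>b\<in>{j..<j + k}. x ! b = x ! (b - (j - i))))"
      using assms(3)
      by (intro freq_cong) (simp add: same_window_tied[OF ij] distinct_windows_take[of _ n m j k, folded h_def])
    also have "\<dots> = freq n m (\<lambda>x. distinct_windows k h (take j x)) / real m ^ card {j..<j + k}"
      using assms ij by (intro freq_prefix_and_tied_letters) auto
    also have "freq n m (\<lambda>x. distinct_windows k h (take j x)) = freq n m (distinct_windows k h)"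
      using assms(3)
      by (intro freq_cong) (simp add: distinct_windows_take[of _ n m j k, folded h_def])
    finally show ?thesis by simp
  qed
  have "freq n m (\<lambda>x. distinct_windows k h x \<and> (\<exists>i<h. same_window k i j x))
    = freq n m (\<lambda>x. \<exists>i\<in>{..<h}. distinct_windows k h x \<and> same_window k i j x)"
    by (intro freq_cong) auto
  also have "\<dots> = (\<Sum>i<h. freq n m (\<lambda>x. distinct_windows k h x \<and> same_window k i j x))"
  proof (rule freq_Bex_eq)
    fix i i' x
    assume "i \<in> {..<h}" "i' \<in> {..<h}"
      and "distinct_windows k h x \<and> same_window k i j x" "distinct_windows k h x \<and> same_window k i' j x"
    moreover from this have "same_window k i i' x" "same_window k i' i x"
      by (simp_all add: same_window_def)
    ultimately show "i = i'"
      unfolding distinct_windows_def by (cases i i' rule: linorder_cases) auto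
  qed simp
  also have "\<dots> = real h / real m ^ k * freq n m (distinct_windows k h)"
    using one by simp
  finally show ?thesis .
qed

text \<open>
  The letters from \<open>s\<close> to the end of the window at \<open>j\<close> are all tied: there are at least \<open>k + 1\<close>
  of them. The bound is attained when the second repeat merely continues the first by one letter,
  that is, when \<open>j = s + 1\<close> and \<open>i' = i + 1\<close>.
\<close>
lemma freq_two_repeats_le:
  assumes "m \<ge> 1" "i < s" "i' < j" "s < j" "j < s + k" "j + k \<le> n"
  shows "freq n m (\<lambda>x. same_window k i s x \<and> same_window k i' j x) \<le> 1 / real m ^ (k + 1)"
proof -
  define g where "g b = (if b < s + k then b - (s - i) else b - (j - i'))" for b
  have "freq n m (\<lambda>x. same_window k i s x \<and> same_window k i' j x)
     \<le> freq n m (\<lambda>x. \<forall>b\<in>{s..<j + k}. x ! b = x ! g b)"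
  proof (rule freq_mono)
    fix x assume "same_window k i s x \<and> same_window k i' j x"
    then have L: "\<forall>b\<in>{s..<s + k}. x ! b = x ! (b - (s - i))"
        "\<forall>b\<in>{j..<j + k}. x ! b = x ! (b - (j - i'))"
      using same_window_tied assms(2,3) by blast+
    show "\<forall>b\<in>{s..<j + k}. x ! b = x ! g b"
    proof
      fix b assume "b \<in> {s..<j + k}"
      then consider "b < s + k" "b \<in> {s..<s + k}" | "\<not> b < s + k" "b \<in> {j..<j + k}"
        using assms(5) by fastforce
      then show "x ! b = x ! g b"
      proof cases
        case 1
        then have "g b = b - (s - i)" by (simp add: g_def)
        with 1 L(1) show ?thesis by simp
      next
        case 2
        then have "g b = b - (j - i')" by (simp add: g_def)
        with 2 L(2) show ?thesis by simp
      qed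
    qed
  qed
  also have "\<dots> = 1 / real m ^ card {s..<j + k}"
    using assms by (intro freq_tied_letters) (auto simp: g_def)
  also have "\<dots> \<le> 1 / real m ^ (k + 1)"
    using assms by (intro divide_left_mono power_increasing) auto
  finally show ?thesis .
qed

text \<open>
  A letter in both windows \<open>s\<close> and \<open>j\<close> is tied to two earlier letters, at the distances \<open>s - i\<close> and
  \<open>j - i'\<close>. As the distances differ, this ties the nearer of those two letters to the farther one.
  The nearer letter lies before \<open>s\<close> because both distances are at least \<open>k\<close>, so these \<open>s + k - j\<close>
  secondary ties are at new positions: together with the \<open>j + k - s\<close> positions from \<open>s\<close> on there
  are \<open>2 * k\<close> tied letters.
\<close>
lemma freq_two_unrelated_repeats_le:
  assumes "m \<ge> 1" "i + k \<le> s" "i' + k \<le> j" "s < j" "j < s + k" "j + k \<le> n" "s - i \<noteq> j - i'"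
  shows "freq n m (\<lambda>x. same_window k i s x \<and> same_window k i' j x) \<le> 1 / real m ^ (2 * k)"
proof -
  have lt: "i < s" "i' < j" using assms by auto
  define d where "d = min (s - i) (j - i')"
  define e where "e = max (s - i) (j - i')"
  have de: "d < e" "k \<le> d" "e \<le> j" using assms unfolding d_def e_def by auto
  \<comment> \<open>The second interval holds the letters at distance \<open>d\<close> before the overlap of the windows at
    \<open>s\<close> and \<open>j\<close>.\<close>
  define S where "S = {s..<j + k} \<union> {j - d..<s + k - d}"
  define g where "g b = (if b < s then b - (e - d) else if b < s + k then b - (s - i) else b - (j - i'))" for b
  have "x ! b = x ! g b"
    if L: "same_window k i s x" "same_window k i' j x" and b: "b \<in> S" for x b
  proof (cases "b < s")
    case False
    have "x ! b = x ! (b - (s - i))" if "b < s + k"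
      using L(1) False that by (simp add: same_window_tied[OF lt(1)])
    moreover have "x ! b = x ! (b - (j - i'))" if "\<not> b < s + k"
    proof -
      have "b \<in> {j..<j + k}" using b that \<open>j < s + k\<close> by (auto simp: S_def)
      then show ?thesis using L(2) unfolding same_window_tied[OF lt(2)] by blast
    qed
    ultimately show ?thesis using False by (simp add: g_def)
  next
    case True
    have b1: "b + d \<in> {j..<s + k}" using b True de assms unfolding S_def by auto
    then have "b + d \<in> {s..<s + k}" "b + d \<in> {j..<j + k}" using \<open>s < j\<close> by auto
    then have eqs: "x ! (b + d) = x ! (b + d - (s - i))" "x ! (b + d) = x ! (b + d - (j - i'))"
      using L lt by (metis same_window_tied)+
    have "x ! (b + d - d) = x ! (b + d - e)"
    proof (cases "s - i \<le> j - i'")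
      case True
      then have "d = s - i" "e = j - i'" by (auto simp: d_def e_def)
      then show ?thesis using eqs by metis
    next
      case False
      then have "e = s - i" "d = j - i'" by (auto simp: d_def e_def)
      then show ?thesis using eqs by metis
    qed
    moreover have "b + d - e = g b" using True de by (simp add: g_def)
    ultimately show ?thesis by simp
  qed
  then have "freq n m (\<lambda>x. same_window k i s x \<and> same_window k i' j x)
     \<le> freq n m (\<lambda>x. \<forall>b\<in>S. x ! b = x ! g b)"
    by (intro freq_mono) blast
  also have "\<dots> = 1 / real m ^ card S"
    using assms lt de by (intro freq_tied_letters) (auto simp: g_def S_def)
  also have "card S = 2 * k"
    unfolding S_def using assms de by (subst card_Un_disjoint) auto
  finally show ?thesis .
qed

lemma distinct_windows_Suc:
  "distinct_windows k (Suc J) x \<longleftrightarrow> distinct_windows k J x \<and> \<not> (\<exists>i<J. same_window k i J x)"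
  unfolding distinct_windows_def using less_Suc_eq by auto

lemma freq_distinct_windows_diff:
  "freq n m (distinct_windows k j) - freq n m (distinct_windows k (Suc j))
     = freq n m (\<lambda>x. distinct_windows k j x \<and> (\<exists>i<j. same_window k i j x))"
  using freq_split[of n m "distinct_windows k j" "\<lambda>x. \<exists>i<j. same_window k i j x"]
  by (simp add: distinct_windows_Suc[abs_def])

lemma freq_repeat_in_le:
  assumes "m \<ge> 1" "j + k \<le> n" "I \<subseteq> {..<j}"
  shows "freq n m (\<lambda>x. \<exists>i\<in>I. same_window k i j x) \<le> card I / real m ^ k"
proof -
  have "finite I" using assms(3) finite_subset by blast
  then have "freq n m (\<lambda>x. \<exists>i\<in>I. same_window k i j x) \<le> (\<Sum>i\<in>I. freq n m (same_window k i j))"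
    by (rule freq_Bex_le)
  also have "\<dots> = (\<Sum>i\<in>I. 1 / real m ^ k)"
    using assms by (intro sum.cong) (auto intro!: freq_same_window)
  finally show ?thesis by simp
qed

text \<open>
  The union bound over the copies \<open>i\<close> and \<open>i'\<close>. All but \<open>k * j\<close> of the at most \<open>j\<^sup>2\<close> pairs fall
  under the strong bound; the exceptions are the pairs in which the window at \<open>s\<close> overlaps its copy
  (fewer than \<open>k\<close> values of \<open>i\<close>) and those at equal distances (one \<open>i'\<close> for each \<open>i\<close>).
\<close>
lemma freq_two_repeats_sum_le:
  assumes "m \<ge> 1" "k \<ge> 1" "h + k \<le> j + 1" "h \<le> s" "s < j" "j < s + k" "j + k \<le> n"
  shows "freq n m (\<lambda>x. \<exists>p\<in>{..<s} \<times> {..<h}. same_window k (fst p) s x \<and> same_window k (snd p) j x)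
       \<le> (real j)\<^sup>2 / (real m ^ k)\<^sup>2 + real k * real j / (real m ^ k * real m)"
proof -
  define q where "q = 1 / (real m ^ k * real m)"
  have q: "q \<ge> 0" by (simp add: q_def)
  have pair: "freq n m (\<lambda>x. same_window k i s x \<and> same_window k i' j x)
      \<le> 1 / (real m ^ k)\<^sup>2 + (if s < i + k then q else 0) + (if i' = j + i - s then q else 0)"
    if "i < s" "i' < h" for i i'
  proof (cases "s < i + k \<or> i' = j + i - s")
    case True
    have "freq n m (\<lambda>x. same_window k i s x \<and> same_window k i' j x) \<le> q"
      using freq_two_repeats_le[of m i s i' j k n] that assms by (simp add: q_def mult.commute)
    moreover have "0 \<le> 1 / (real m ^ k)\<^sup>2" by simp
    ultimately show ?thesis using True q by (smt (verit))
  next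
    case False
    then have "s - i \<noteq> j - i'" using that assms by auto
    then show ?thesis
      using freq_two_unrelated_repeats_le[of m i k s i' j n] that assms False
      by (simp add: power_mult[symmetric] mult.commute)
  qed
  have near: "(\<Sum>i<s. if s < i + k then q else 0) \<le> real (k - 1) * q"
  proof -
    have "{i \<in> {..<s}. s < i + k} \<subseteq> {s + 1 - k..<s}" by auto
    then have "card {i \<in> {..<s}. s < i + k} \<le> card {s + 1 - k..<s}" by (intro card_mono) auto
    then have "card {i \<in> {..<s}. s < i + k} \<le> k - 1" by simp
    then show ?thesis using q by (simp flip: sum.inter_filter add: mult_right_mono)
  qed
  have parallel: "(\<Sum>i'<h. if i' = j + i - s then q else 0) \<le> q" for i
    using q by (simp add: sum.delta)
  have "freq n m (\<lambda>x. \<exists>p\<in>{..<s} \<times> {..<h}. same_window k (fst p) s x \<and> same_window k (snd p) j x)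
     \<le> (\<Sum>p\<in>{..<s} \<times> {..<h}. freq n m (\<lambda>x. same_window k (fst p) s x \<and> same_window k (snd p) j x))"
    by (rule freq_Bex_le) simp
  also have "\<dots> \<le> (\<Sum>p\<in>{..<s} \<times> {..<h}. 1 / (real m ^ k)\<^sup>2 + (if s < fst p + k then q else 0)
      + (if snd p = j + fst p - s then q else 0))"
    using pair by (intro sum_mono) (simp only: mem_Times_iff lessThan_iff)
  also have "\<dots> = (\<Sum>i<s. \<Sum>i'<h. 1 / (real m ^ k)\<^sup>2 + (if s < i + k then q else 0)
      + (if i' = j + i - s then q else 0))"
    by (simp add: sum.cartesian_product case_prod_unfold)
  also have "\<dots> = real s * real h / (real m ^ k)\<^sup>2 + real h * (\<Sum>i<s. if s < i + k then q else 0)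
      + (\<Sum>i<s. \<Sum>i'<h. if i' = j + i - s then q else 0)"
    by (simp only: sum.distrib sum_constant card_lessThan sum_distrib_left of_nat_mult) simp
  also have "\<dots> \<le> real j * real j / (real m ^ k)\<^sup>2 + real j * (real (k - 1) * q) + (\<Sum>i<j. q)"
  proof (intro add_mono)
    show "real s * real h / (real m ^ k)\<^sup>2 \<le> real j * real j / (real m ^ k)\<^sup>2"
      using assms by (intro divide_right_mono mult_mono) auto
    show "real h * (\<Sum>i<s. if s < i + k then q else 0) \<le> real j * (real (k - 1) * q)"
      using assms near q by (intro mult_mono) (auto intro: sum_nonneg)
    have "(\<Sum>i<s. \<Sum>i'<h. if i' = j + i - s then q else 0) \<le> (\<Sum>i<s. q)"
      by (rule sum_mono) (rule parallel)
    also have "\<dots> \<le> (\<Sum>i<j. q)" using assms q by (intro sum_mono2) auto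
    finally show "(\<Sum>i<s. \<Sum>i'<h. if i' = j + i - s then q else 0) \<le> (\<Sum>i<j. q)" .
  qed
  also have "\<dots> = (real j)\<^sup>2 / (real m ^ k)\<^sup>2 + real k * real j * q"
    using \<open>k \<ge> 1\<close> by (simp add: power2_eq_square of_nat_diff algebra_simps)
  finally show ?thesis by (simp add: q_def)
qed

text \<open>
  The drop from \<open>j\<close> to \<open>Suc j\<close> windows is the probability that the window at \<open>j\<close> is the first one to
  repeat. It is compared with the event of \<open>freq_new_window_repeats_old\<close>, in which the windows starting in
  the last \<open>k - 1\<close> positions before \<open>j\<close> are ignored. The two events differ only if the window at \<open>j\<close>
  equals an ignored one (the term \<open>k / M\<close>), or if an ignored window is a repeat too, in which case
  there are two repeats within \<open>k\<close> steps.
\<close>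
lemma freq_first_repeat_approx:
  assumes "m \<ge> 1" "k \<ge> 1" "j + k \<le> n"
  defines "M \<equiv> real m ^ k" and "h \<equiv> j + 1 - k"
  shows "\<bar>freq n m (distinct_windows k j) - freq n m (distinct_windows k (Suc j))
           - real h / M * freq n m (distinct_windows k h)\<bar>
       \<le> real k / M + real k * ((real j)\<^sup>2 / M\<^sup>2 + real k * real j / (M * real m))"
proof -
  define B where "B x \<longleftrightarrow> distinct_windows k j x \<and> (\<exists>i<j. same_window k i j x)" for x
  define E where "E x \<longleftrightarrow> distinct_windows k h x \<and> (\<exists>i<h. same_window k i j x)" for x
  define D where "D s x \<longleftrightarrow>
    (\<exists>p\<in>{..<s} \<times> {..<h}. same_window k (fst p) s x \<and> same_window k (snd p) j x)" for s x
  have hj: "h \<le> j" "j - h \<le> k" using assms by auto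
  have BE: "freq n m (\<lambda>x. B x \<and> \<not> E x) \<le> real k / M"
  proof -
    have "freq n m (\<lambda>x. B x \<and> \<not> E x) \<le> freq n m (\<lambda>x. \<exists>i\<in>{h..<j}. same_window k i j x)"
    proof (rule freq_mono)
      fix x assume x: "B x \<and> \<not> E x"
      then obtain i where i: "i < j" "same_window k i j x" by (auto simp: B_def)
      have "distinct_windows k h x" using x hj by (auto simp: B_def distinct_windows_def)
      then have "\<not> i < h" using x i by (auto simp: E_def)
      then show "\<exists>i\<in>{h..<j}. same_window k i j x" using i by auto
    qed
    also have "\<dots> \<le> card {h..<j} / real m ^ k"
      using assms by (intro freq_repeat_in_le) auto
    also have "\<dots> \<le> real k / M"
      unfolding M_def using hj by (intro divide_right_mono) auto
    finally show ?thesis .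
  qed
  have EB: "freq n m (\<lambda>x. E x \<and> \<not> B x) \<le> real k * ((real j)\<^sup>2 / M\<^sup>2 + real k * real j / (M * real m))"
  proof -
    have "freq n m (\<lambda>x. E x \<and> \<not> B x) \<le> freq n m (\<lambda>x. \<exists>s\<in>{h..<j}. D s x)"
    proof (rule freq_mono)
      fix x assume x: "E x \<and> \<not> B x"
      then obtain i' where i': "i' < h" "same_window k i' j x" by (auto simp: E_def)
      then have "\<not> distinct_windows k j x" using x hj by (auto simp: B_def)
      then obtain s i where s: "s < j" "i < s" "same_window k i s x" by (auto simp: distinct_windows_def)
      then have "h \<le> s" using x by (meson E_def distinct_windows_def not_le)
      then show "\<exists>s\<in>{h..<j}. D s x" using s i' by (fastforce simp: D_def)
    qed
    also have "\<dots> \<le> (\<Sum>s\<in>{h..<j}. freq n m (D s))" by (rule freq_Bex_le) simp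
    also have "\<dots> \<le> (\<Sum>s\<in>{h..<j}. (real j)\<^sup>2 / M\<^sup>2 + real k * real j / (M * real m))"
    proof (rule sum_mono)
      fix s assume s: "s \<in> {h..<j}"
      show "freq n m (D s) \<le> (real j)\<^sup>2 / M\<^sup>2 + real k * real j / (M * real m)"
      proof (cases "h = 0")
        case True
        then have "freq n m (D s) = 0" by (simp add: D_def[abs_def] freq_def)
        then show ?thesis by (simp add: M_def)
      next
        case False
        then show ?thesis
          unfolding D_def M_def using assms s h_def by (intro freq_two_repeats_sum_le) auto
      qed
    qed
    also have "\<dots> = real (j - h) * ((real j)\<^sup>2 / M\<^sup>2 + real k * real j / (M * real m))" by simp
    also have "\<dots> \<le> real k * ((real j)\<^sup>2 / M\<^sup>2 + real k * real j / (M * real m))"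
      using hj by (intro mult_right_mono) (auto simp: M_def)
    finally show ?thesis .
  qed
  have "freq n m (distinct_windows k j) - freq n m (distinct_windows k (Suc j)) = freq n m B"
    by (simp add: freq_distinct_windows_diff B_def[abs_def])
  moreover have "real h / M * freq n m (distinct_windows k h) = freq n m E"
    using freq_new_window_repeats_old[OF assms(1-3)] by (simp add: E_def[abs_def] M_def h_def)
  moreover have "0 \<le> real k / M"  "0 \<le> real k * ((real j)\<^sup>2 / M\<^sup>2 + real k * real j / (M * real m))"
    by (simp_all add: M_def)
  ultimately show ?thesis
    using freq_diff_le[of n m B E] freq_diff_le[of n m E B] BE EB by linarith
qed

lemma freq_distinct_windows_drop_le:
  assumes "m \<ge> 1" "h \<le> j" "j + k \<le> n + 1"
  shows "freq n m (distinct_windows k h) - freq n m (distinct_windows k j) \<le> real (j - h) * real j / real m ^ k"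
  using assms(2,3)
proof (induction j rule: dec_induct)
  case base
  then show ?case by simp
next
  case (step j)
  have "freq n m (distinct_windows k j) - freq n m (distinct_windows k (Suc j))
     \<le> freq n m (\<lambda>x. \<exists>i\<in>{..<j}. same_window k i j x)"
    unfolding freq_distinct_windows_diff by (rule freq_mono) auto
  also have "\<dots> \<le> real j / real m ^ k"
    using freq_repeat_in_le[of m j k n "{..<j}"] step.prems assms(1) by simp
  finally have "freq n m (distinct_windows k h) - freq n m (distinct_windows k (Suc j))
     \<le> real (j - h) * real j / real m ^ k + real j / real m ^ k"
    using step.IH step.prems by simp
  also have "\<dots> = real (Suc j - h) * real j / real m ^ k"
    using step.hyps by (simp add: Suc_diff_le distrib_right add_divide_distrib)
  also have "\<dots> \<le> real (Suc j - h) * real (Suc j) / real m ^ k"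
    by (intro divide_right_mono mult_left_mono) auto
  finally show ?case .
qed

section \<open>The probability that all windows are distinct\<close>

lemma abs_exp_minus_linear_le:
  fixes t :: real
  assumes "t \<ge> 0"
  shows "\<bar>1 - t - exp (- t)\<bar> \<le> t\<^sup>2"
proof -
  have "exp (- t) \<le> 1 / (1 + t)"
    using assms exp_ge_add_one_self[of t] by (simp add: exp_minus field_simps)
  also have "\<dots> \<le> 1 - t + t\<^sup>2"
  proof -
    have "(1 - t + t\<^sup>2) * (1 + t) = 1 + t ^ 3" by (simp add: algebra_simps power2_eq_square power3_eq_cube)
    then have "1 \<le> (1 - t + t\<^sup>2) * (1 + t)" using assms by simp
    then show ?thesis using assms by (simp add: divide_le_eq)
  qed
  finally show ?thesis using exp_ge_add_one_self[of "- t"] by (simp add: abs_le_iff)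
qed

text \<open>
  The exact factor would be \<open>1 - j / M\<close> if a new window hit each of the \<open>j\<close> earlier ones with
  probability \<open>1 / M\<close>. The exponential replaces it so that the product over \<open>j\<close> is explicit; since
  \<open>j\<close> will be of order \<open>sqrt M\<close>, the price \<open>(j / M)\<^sup>2\<close> is of the order of the other errors.
\<close>
lemma freq_distinct_windows_step:
  assumes "m \<ge> 1" "k \<ge> 1" "j + k \<le> n"
  defines "M \<equiv> real m ^ k"
  shows "\<bar>freq n m (distinct_windows k (Suc j)) - exp (- (real j / M)) * freq n m (distinct_windows k j)\<bar>
    \<le> 2 * real k / M + (2 * real k + 1) * (real j)\<^sup>2 / M\<^sup>2 + (real k)\<^sup>2 * real j / (M * real m)"
proof -
  define h where "h = j + 1 - k"
  define F where "F J = freq n m (distinct_windows k J)" for J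
  define u where "u = real j / M"
  have hj: "h \<le> j" "j - h \<le> k" using assms by (auto simp: h_def)
  have M: "M > 0" using assms by (simp add: M_def)
  have F: "0 \<le> F J" "F J \<le> 1" for J using assms by (simp_all add: F_def freq_nonneg freq_le_1)
  have u: "u \<ge> 0" using M by (simp add: u_def)
  have anti: "F j \<le> F h" unfolding F_def using hj by (intro freq_mono) (auto simp: distinct_windows_def)
  have drop: "F h - F j \<le> real k * u"
  proof -
    have "F h - F j \<le> real (j - h) * real j / M"
      unfolding F_def M_def using assms hj by (intro freq_distinct_windows_drop_le) auto
    also have "\<dots> \<le> real k * real j / M"
      using hj M by (intro divide_right_mono mult_right_mono) auto
    finally show ?thesis by (simp add: u_def)
  qed
  have linear: "\<bar>(1 - u - exp (- u)) * F j\<bar> \<le> u\<^sup>2"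
    using mult_mono[OF abs_exp_minus_linear_le[OF u] F(2)[of j]] F(1)[of j] by (simp add: abs_mult)
  have shift: "u * F j - real h / M * F h = real (j - h) / M * F j - real h / M * (F h - F j)"
    using hj M by (simp add: u_def of_nat_diff field_simps)
  have lag1: "0 \<le> real (j - h) / M * F j" "real (j - h) / M * F j \<le> real k / M"
    using mult_mono[of "real (j - h) / M" "real k / M" "F j" 1] F[of j] hj M
    by (auto simp: divide_right_mono)
  have lag2: "0 \<le> real h / M * (F h - F j)" "real h / M * (F h - F j) \<le> real k * u\<^sup>2"
  proof -
    show "0 \<le> real h / M * (F h - F j)" using anti M by simp
    have "real h / M * (F h - F j) \<le> u * (real k * u)"
      using hj M drop anti u by (intro mult_mono) (auto simp: u_def divide_right_mono)
    then show "real h / M * (F h - F j) \<le> real k * u\<^sup>2" by (simp add: power2_eq_square algebra_simps)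
  qed
  have main: "\<bar>F j - F (Suc j) - real h / M * F h\<bar> \<le> real k / M + real k * (u\<^sup>2 + real k * real j / (M * real m))"
    using freq_first_repeat_approx[OF assms(1-3)] by (simp add: F_def h_def M_def u_def power_divide)
  \<comment> \<open>The two lags of replacing \<open>h\<close> by \<open>j\<close>, in the number of windows and in the probability, have
    opposite signs and are bounded separately.\<close>
  have combine: "\<bar>x\<bar> \<le> a + b + (c + d)"
    if "\<bar>y\<bar> \<le> a" "\<bar>z\<bar> \<le> b" "0 \<le> v" "v \<le> c" "0 \<le> w" "w \<le> d" "x = - y + z + (v - w)"
    for x y z v w a b c d :: real
    using that by linarith
  have "F (Suc j) - exp (- u) * F j
      = - (F j - F (Suc j) - real h / M * F h) + (1 - u - exp (- u)) * F j + (u * F j - real h / M * F h)"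
    by (simp add: algebra_simps)
  then have "\<bar>F (Suc j) - exp (- u) * F j\<bar>
     \<le> (real k / M + real k * (u\<^sup>2 + real k * real j / (M * real m))) + u\<^sup>2 + (real k / M + real k * u\<^sup>2)"
    unfolding shift by (rule combine[OF main linear lag1 lag2])
  also have "\<dots> = 2 * (real k / M) + (2 * real k + 1) * u\<^sup>2 + real k * (real k * real j / (M * real m))"
    by (simp add: algebra_simps)
  finally show ?thesis
    by (simp add: F_def u_def power_divide power2_eq_square mult.assoc)
qed

text \<open>
  The one-step errors add up because the factors \<open>exp (- (j / M))\<close> do not magnify earlier errors;
  the exponent is the sum of \<open>j / M\<close> over \<open>j < J\<close>. For \<open>J\<close> of order \<open>sqrt M\<close> the total error tends to
  \<open>0\<close> like \<open>1 / sqrt M + 1 / m\<close>.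
\<close>
lemma freq_distinct_windows_approx:
  assumes "m \<ge> 1" "k \<ge> 1" "J + k \<le> n"
  defines "M \<equiv> real m ^ k"
  shows "\<bar>freq n m (distinct_windows k J) - exp (- (real J * (real J - 1) / (2 * M)))\<bar>
    \<le> real J * (2 * real k / M + (2 * real k + 1) * (real J)\<^sup>2 / M\<^sup>2 + (real k)\<^sup>2 * real J / (M * real m))"
proof -
  define D where "D = 2 * real k / M + (2 * real k + 1) * (real J)\<^sup>2 / M\<^sup>2 + (real k)\<^sup>2 * real J / (M * real m)"
  define F where "F j = freq n m (distinct_windows k j)" for j
  define G where "G j = exp (- (real j * (real j - 1) / (2 * M)))" for j
  have M: "M > 0" using assms by (simp add: M_def)
  have "\<bar>F j - G j\<bar> \<le> real j * D" if "j \<le> J" for j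
    using that
  proof (induction j)
    case 0
    show ?case
      using assms(1) by (simp add: F_def G_def distinct_windows_def[abs_def] freq_True)
  next
    case (Suc j)
    have G: "G (Suc j) = exp (- (real j / M)) * G j"
      unfolding G_def using M by (simp flip: exp_add) (simp add: field_simps)
    have "\<bar>F (Suc j) - exp (- (real j / M)) * F j\<bar>
       \<le> 2 * real k / M + (2 * real k + 1) * (real j)\<^sup>2 / M\<^sup>2 + (real k)\<^sup>2 * real j / (M * real m)"
      using freq_distinct_windows_step[of m k j n] assms Suc.prems by (simp add: F_def)
    also have "\<dots> \<le> D"
      unfolding D_def using Suc.prems M
      by (intro add_mono divide_right_mono mult_left_mono power_mono) auto
    finally have step: "\<bar>F (Suc j) - exp (- (real j / M)) * F j\<bar> \<le> D" .
    have "\<bar>exp (- (real j / M)) * (F j - G j)\<bar> \<le> 1 * (real j * D)"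
      unfolding abs_mult using Suc M by (intro mult_mono) auto
    moreover have "F (Suc j) - G (Suc j)
        = (F (Suc j) - exp (- (real j / M)) * F j) + exp (- (real j / M)) * (F j - G j)"
      by (simp add: G algebra_simps)
    ultimately have "\<bar>F (Suc j) - G (Suc j)\<bar> \<le> D + real j * D" using step by linarith
    then show ?case by (simp add: algebra_simps)
  qed
  then show ?thesis by (simp add: F_def G_def D_def)
qed

section \<open>The first repeat of the shift register sequence\<close>

definition seq_prefix :: "nat \<Rightarrow> (nat list \<Rightarrow> nat) \<Rightarrow> nat list \<Rightarrow> nat \<Rightarrow> nat list" where
  "seq_prefix k f w n = map (X_seq k f w) [1..<n + 1]"

lemma length_seq_prefix [simp]: "length (seq_prefix k f w n) = n"
  by (simp add: seq_prefix_def)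

lemma nth_seq_prefix [simp]: "i < n \<Longrightarrow> seq_prefix k f w n ! i = X_seq k f w (i + 1)"
  by (simp add: seq_prefix_def nth_upt del: upt_Suc)

lemma window_eq_block:
  assumes "i + k \<le> n"
  shows "window k f w (i + 1) = take k (drop i (seq_prefix k f w n))"
  using assms by (intro nth_equalityI) (simp_all add: window_def nth_upt del: upt_Suc)

lemma same_window_seq_prefix:
  assumes "i + k \<le> n" "j + k \<le> n"
  shows "same_window k i j (seq_prefix k f w n) \<longleftrightarrow> window k f w (i + 1) = window k f w (j + 1)"
  using assms
  by (auto simp: same_window_def window_def list_eq_iff_nth_eq simp del: upt_Suc)

lemma seq_prefix_in_tuples:
  assumes "f \<in> feedback_funs k m" "w \<in> tuples k m" "k \<ge> 1"
  shows "seq_prefix k f w n \<in> tuples n m"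
proof -
  have "X_seq k f w i \<in> {1..m}" if "i \<ge> 1" for i
  proof -
    have "window k f w i ! 0 = X_seq k f w i" using \<open>k \<ge> 1\<close> by (simp add: window_def del: upt_Suc)
    moreover have "window k f w i ! 0 \<in> {1..m}"
      using window_in_tuples[OF assms(1,2) that] \<open>k \<ge> 1\<close> by (intro nth_tuples) auto
    ultimately show ?thesis by simp
  qed
  then show ?thesis by (auto simp: tuples_def seq_prefix_def simp del: upt_Suc)
qed

text \<open>
  The time \<open>t\<close> in the definition of \<open>tau\<close> is the index of the last letter of a window, so it stands
  for the window numbered \<open>t - k\<close> from \<open>0\<close>. The truncated subtraction gives no windows at all if
  \<open>N \<le> k\<close>.
\<close>
lemma le_tau_iff:
  assumes "f \<in> feedback_funs k m" "w \<in> tuples k m"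
  shows "N \<le> tau k f w \<longleftrightarrow> distinct_windows k (N - k) (seq_prefix k f w (N - k + k))"
proof -
  define P where "P t \<longleftrightarrow> (\<exists>\<mu>. k \<le> \<mu> \<and> \<mu> < t \<and> window k f w (t - k + 1) = window k f w (\<mu> - k + 1))" for t
  have tau: "tau k f w = (LEAST t. P t)" by (simp add: tau_def P_def)
  obtain t0 where "P t0" using tau_exists[OF assms] by (auto simp: P_def)
  then have "P (tau k f w)" unfolding tau by (rule LeastI)
  moreover have "tau k f w \<le> t" if "P t" for t using that unfolding tau by (rule Least_le)
  ultimately have "N \<le> tau k f w \<longleftrightarrow> (\<forall>t. P t \<longrightarrow> N \<le> t)" using le_trans by blast
  also have "\<dots> \<longleftrightarrow> (\<forall>j<N - k. \<forall>i<j. window k f w (i + 1) \<noteq> window k f w (j + 1))"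
  proof (intro iffI allI impI notI)
    fix j i assume *: "\<forall>t. P t \<longrightarrow> N \<le> t" "j < N - k" "i < j" "window k f w (i + 1) = window k f w (j + 1)"
    then have "P (j + k)" unfolding P_def by (intro exI[of _ "i + k"]) simp
    then show False using * by fastforce
  next
    fix t assume *: "\<forall>j<N - k. \<forall>i<j. window k f w (i + 1) \<noteq> window k f w (j + 1)" "P t"
    then obtain \<mu> where \<mu>: "k \<le> \<mu>" "\<mu> < t" "window k f w (t - k + 1) = window k f w (\<mu> - k + 1)"
      by (auto simp: P_def)
    show "N \<le> t"
    proof (rule ccontr)
      assume "\<not> N \<le> t"
      then have "t - k < N - k" "\<mu> - k < t - k" using \<mu> by auto
      then show False using *(1) \<mu>(3) by metis
    qed
  qed
  also have "\<dots> \<longleftrightarrow> distinct_windows k (N - k) (seq_prefix k f w (N - k + k))"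
    unfolding distinct_windows_def by (auto simp: same_window_seq_prefix)
  finally show ?thesis .
qed

lemma seq_prefix_eq_iff:
  assumes "length w = k" "length u = J + k"
  shows "seq_prefix k f w (J + k) = u
     \<longleftrightarrow> w = take k u \<and> (\<forall>i<J. f (take k (drop i u)) = u ! (i + k))"
proof
  assume u: "seq_prefix k f w (J + k) = u"
  have nth: "u ! p = X_seq k f w (p + 1)" if "p < J + k" for p
    using that unfolding u[symmetric] by simp
  have "w = take k u"
    using assms by (intro nth_equalityI) (simp_all add: nth X_seq_initial)
  moreover have "f (take k (drop i u)) = u ! (i + k)" if "i < J" for i
  proof -
    have "take k (drop i u) = window k f w (i + 1)"
      using window_eq_block[of i k "J + k" f w] that u by simp
    then show ?thesis using X_seq_recurrence[of "i + 1" k f w] nth[of "i + k"] that by (simp add: ac_simps)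
  qed
  ultimately show "w = take k u \<and> (\<forall>i<J. f (take k (drop i u)) = u ! (i + k))" by blast
next
  assume R: "w = take k u \<and> (\<forall>i<J. f (take k (drop i u)) = u ! (i + k))"
  have X: "X_seq k f w (p + 1) = u ! p" if "p < J + k" for p
    using that
  proof (induction p rule: less_induct)
    case (less p)
    show ?case
    proof (cases "p < k")
      case True
      then show ?thesis using R by (simp add: X_seq_initial)
    next
      case False
      define i where "i = p - k"
      then have p: "p = i + k" "i < J" using False less.prems by auto
      have "window k f w (i + 1) = take k (drop i u)"
        using less.IH p assms by (intro nth_equalityI) (simp_all add: window_def nth_upt del: upt_Suc)
      then show ?thesis using R p X_seq_recurrence[of "i + 1" k f w] by (simp add: ac_simps)
    qed
  qed
  show "seq_prefix k f w (J + k) = u"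
    using assms X by (intro nth_equalityI) simp_all
qed

lemma card_feedback_funs: "card (feedback_funs k m) = m ^ (m ^ k)"
  by (simp add: feedback_funs_def card_PiE finite_tuples card_tuples)

lemma card_feedback_funs_prescribed:
  assumes "D \<subseteq> tuples k m" "\<And>d. d \<in> D \<Longrightarrow> c d \<in> {1..m}"
  shows "card {f \<in> feedback_funs k m. \<forall>d\<in>D. f d = c d} * m ^ card D = m ^ (m ^ k)"
proof -
  have fin: "finite D" using assms(1) finite_tuples finite_subset by blast
  have le: "card D \<le> m ^ k" using card_mono[OF finite_tuples assms(1)] by (simp add: card_tuples)
  have "{f \<in> feedback_funs k m. \<forall>d\<in>D. f d = c d}
      = (\<Pi>\<^sub>E t\<in>tuples k m. if t \<in> D then {c t} else {1..m})"
  proof -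
    have "y \<in> (if t \<in> D then {c t} else {1..m}) \<longleftrightarrow> y \<in> {1..m} \<and> (t \<in> D \<longrightarrow> y = c t)" for t y
      using assms(2) by auto
    then show ?thesis
      unfolding feedback_funs_def set_eq_iff mem_Collect_eq PiE_iff using assms(1) by blast
  qed
  also have "card \<dots> = (\<Prod>t\<in>tuples k m. if t \<in> D then 1 else m)"
    by (auto simp: card_PiE finite_tuples intro!: prod.cong)
  also have "\<dots> = m ^ card (tuples k m - D)"
    using assms(1) by (simp add: prod.If_cases finite_tuples Diff_eq)
  also have "card (tuples k m - D) = m ^ k - card D"
    using assms(1) fin by (simp add: card_Diff_subset card_tuples)
  finally show ?thesis using le by (simp flip: power_add)
qed

text \<open>
  The initial letters of the sequence fix \<open>w\<close>, and each further letter prescribes the value of \<open>f\<close> at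
  one window. The first \<open>J\<close> windows being distinct, these are prescriptions at \<open>J\<close> different
  points, so all words with distinct windows are equally likely as prefixes.
\<close>
lemma card_seq_prefix_eq:
  assumes "u \<in> tuples (J + k) m" "distinct_windows k J u"
  shows "card {(f, w) \<in> feedback_funs k m \<times> tuples k m. seq_prefix k f w (J + k) = u} * m ^ J = m ^ (m ^ k)"
proof -
  define v where "v i = take k (drop i u)" for i
  define D where "D = v ` {..<J}"
  \<comment> \<open>The value prescribed at a window is the letter that follows it in \<open>u\<close>.\<close>
  define c where "c d = u ! (the_inv_into {..<J} v d + k)" for d
  have len: "length u = J + k" using assms(1) by (rule length_tuples)
  have v: "v i \<in> tuples k m" if "i < J" for i
    using that assms(1) set_drop_subset[of i u] set_take_subset[of k "drop i u"]
    by (auto simp: v_def tuples_def)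
  have "v i \<noteq> v j" if "i < j" "j < J" for i j
  proof
    assume eq: "v i = v j"
    have "u ! (i + t) = u ! (j + t)" if "t < k" for t
      using arg_cong[OF eq, of "\<lambda>x. x ! t"] that \<open>i < j\<close> \<open>j < J\<close> len by (simp add: v_def)
    then show False using assms(2) that by (auto simp: distinct_windows_def same_window_def)
  qed
  then have inj: "inj_on v {..<J}" unfolding inj_on_def by (metis lessThan_iff linorder_neqE_nat)
  have c: "c (v i) = u ! (i + k)" if "i < J" for i
    using that inj by (simp add: c_def the_inv_into_f_f)
  have "{(f, w) \<in> feedback_funs k m \<times> tuples k m. seq_prefix k f w (J + k) = u}
     = {f \<in> feedback_funs k m. \<forall>d\<in>D. f d = c d} \<times> {take k u}"
  proof -
    have "take k u \<in> tuples k m" using assms(1) set_take_subset[of k u] by (auto simp: tuples_def)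
    moreover have "seq_prefix k f w (J + k) = u \<longleftrightarrow> w = take k u \<and> (\<forall>d\<in>D. f d = c d)"
      if "w \<in> tuples k m" for f w
      unfolding seq_prefix_eq_iff[OF length_tuples[OF that] len] D_def v_def[symmetric] using c by auto
    ultimately show ?thesis by auto
  qed
  then have "card {(f, w) \<in> feedback_funs k m \<times> tuples k m. seq_prefix k f w (J + k) = u}
     = card {f \<in> feedback_funs k m. \<forall>d\<in>D. f d = c d}" by (simp add: card_cartesian_product)
  moreover have "card D = J" using inj by (simp add: D_def card_image)
  moreover have "c d \<in> {1..m}" if "d \<in> D" for d
    using that c nth_tuples[OF assms(1)] by (auto simp: D_def)
  ultimately show ?thesis
    using card_feedback_funs_prescribed[of D k m c] v by (auto simp: D_def)
qed

text \<open>
  Until its first repeated window the sequence cannot be told from independent uniform letters. The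
  word has length \<open>J + k\<close> with \<open>J = N - k\<close>, one letter more than the first \<open>J\<close> windows cover, because
  the values of \<open>f\<close> at these windows are \<open>J\<close> letters that follow the \<open>k\<close> initial ones.
\<close>
lemma prob_le_tau:
  assumes "m \<ge> 1" "k \<ge> 1"
  shows "measure_pmf.prob (model k m) {(f, w). N \<le> tau k f w}
       = freq (N - k + k) m (distinct_windows k (N - k))"
proof -
  define J where "J = N - k"
  define \<Omega> where "\<Omega> = feedback_funs k m \<times> tuples k m"
  define U where "U = {u \<in> tuples (J + k) m. distinct_windows k J u}"
  define A where "A u = {(f, w) \<in> \<Omega>. seq_prefix k f w (J + k) = u}" for u
  have cards: "card (feedback_funs k m) > 0" "card (tuples k m) > 0"
    using assms by (simp_all add: card_feedback_funs card_tuples)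
  have fin: "finite (feedback_funs k m)" "finite (tuples k m)"
    using cards by (simp_all add: card_gt_0_iff)
  have ne: "feedback_funs k m \<noteq> {}" "tuples k m \<noteq> {}" using cards by auto
  have fin': "finite \<Omega>" "\<Omega> \<noteq> {}" using fin ne by (simp_all add: \<Omega>_def)
  have "model k m = pmf_of_set \<Omega>"
    unfolding model_def
    by (intro pmf_eqI)
      (auto simp: pmf_pair pmf_of_set[OF ne(1) fin(1)] pmf_of_set[OF ne(2) fin(2)]
        pmf_of_set[OF fin'(2,1)[unfolded \<Omega>_def]] \<Omega>_def indicator_def card_cartesian_product)
  then have "measure_pmf.prob (model k m) {(f, w). N \<le> tau k f w}
     = real (card (\<Omega> \<inter> {(f, w). N \<le> tau k f w})) / real (card \<Omega>)"
    using fin' by (simp add: measure_pmf_of_set)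
  moreover have "\<Omega> \<inter> {(f, w). N \<le> tau k f w} = (\<Union>u\<in>U. A u)"
    using assms by (auto simp: \<Omega>_def U_def A_def J_def le_tau_iff seq_prefix_in_tuples)
  ultimately have prob: "measure_pmf.prob (model k m) {(f, w). N \<le> tau k f w}
     = real (card (\<Union>u\<in>U. A u)) / real (card \<Omega>)"
    by simp
  have "card (\<Union>u\<in>U. A u) = (\<Sum>u\<in>U. card (A u))"
    by (rule card_UN_disjoint) (auto simp: U_def A_def finite_tuples intro: finite_subset[OF _ fin'(1)])
  moreover have "card (A u) * m ^ J = m ^ (m ^ k)" if "u \<in> U" for u
    using that unfolding A_def \<Omega>_def U_def by (intro card_seq_prefix_eq) auto
  ultimately have "card (\<Union>u\<in>U. A u) * m ^ J = card U * m ^ (m ^ k)"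
    by (simp add: sum_distrib_right)
  from arg_cong[OF this, of real]
  have "real (card (\<Union>u\<in>U. A u)) * real m ^ J = real (card U) * real m ^ (m ^ k)"
    by (simp only: of_nat_mult of_nat_power)
  moreover have "real (card \<Omega>) = real m ^ (m ^ k) * real m ^ k"
    by (simp add: \<Omega>_def card_cartesian_product card_feedback_funs card_tuples)
  ultimately have "real (card (\<Union>u\<in>U. A u)) / real (card \<Omega>) = real (card U) / (real m ^ J * real m ^ k)"
    using assms(1) by (simp add: frac_eq_eq mult_ac)
  then show ?thesis
    unfolding prob freq_def U_def J_def power_add by simp
qed

section \<open>The limit\<close>

text \<open>
  The number of windows that must be distinct for \<open>\<tau> \<ge> sqrt (2 * x * M)\<close>, in units of \<open>sqrt M\<close>.
\<close>
lemma tendsto_normalized_time: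
  fixes x :: real
  assumes "k \<ge> 1" "x \<ge> 0"
  shows "(\<lambda>m. real (nat \<lceil>sqrt (2 * x * real m ^ k)\<rceil> - k) / sqrt (real m ^ k)) \<longlonglongrightarrow> sqrt (2 * x)"
proof (rule real_tendsto_sandwich)
  have s: "filterlim (\<lambda>m. sqrt (real m ^ k)) at_top sequentially"
    using assms by (intro filterlim_compose[OF sqrt_at_top] filterlim_pow_at_top filterlim_real_sequentially) auto
  show "(\<lambda>m. sqrt (2 * x) - real k / sqrt (real m ^ k)) \<longlonglongrightarrow> sqrt (2 * x)"
    using tendsto_diff[OF tendsto_const tendsto_divide_0[OF tendsto_const filterlim_at_top_imp_at_infinity[OF s]]]
    by simp
  show "\<forall>\<^sub>F m in sequentially. sqrt (2 * x) - real k / sqrt (real m ^ k)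
      \<le> real (nat \<lceil>sqrt (2 * x * real m ^ k)\<rceil> - k) / sqrt (real m ^ k)"
    using eventually_ge_at_top[of 1]
  proof eventually_elim
    case (elim m)
    define r where "r = sqrt (2 * x * real m ^ k)"
    have "r \<le> real (nat \<lceil>r\<rceil>)" by linarith
    then have "r - real k \<le> real (nat \<lceil>r\<rceil> - k)" by linarith
    then have "(r - real k) / sqrt (real m ^ k) \<le> real (nat \<lceil>r\<rceil> - k) / sqrt (real m ^ k)"
      by (intro divide_right_mono) auto
    moreover have "sqrt (2 * x) = r / sqrt (real m ^ k)" using elim by (simp add: r_def real_sqrt_mult)
    ultimately show ?case by (simp add: diff_divide_distrib r_def)
  qed
  show "\<forall>\<^sub>F m in sequentially. real (nat \<lceil>sqrt (2 * x * real m ^ k)\<rceil> - k) / sqrt (real m ^ k) \<le> sqrt (2 * x)"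
    using eventually_ge_at_top[of 1]
  proof eventually_elim
    case (elim m)
    define r where "r = sqrt (2 * x * real m ^ k)"
    have "r \<ge> 0" using assms by (simp add: r_def)
    then have "real (nat \<lceil>r\<rceil>) < r + 1" by linarith
    then have "real (nat \<lceil>r\<rceil> - k) \<le> r" using \<open>k \<ge> 1\<close> \<open>r \<ge> 0\<close> by linarith
    moreover have "r = sqrt (2 * x) * sqrt (real m ^ k)" by (simp add: r_def real_sqrt_mult)
    moreover have "sqrt (real m ^ k) > 0" using elim by simp
    ultimately show ?case unfolding r_def[symmetric] by (simp add: field_simps)
  qed
qed simp

theorem theorem1p2:
  fixes k :: nat and x :: real
  assumes "k \<ge> 1" and "x \<ge> 0"
  shows "(\<lambda>m. measure_pmf.prob (model k m)
           {(f, w). (real (tau k f w))\<^sup>2 / (2 * real m ^ k) \<ge> x}) \<longlonglongrightarrow> exp (- x)"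
proof -
  define J where "J m = nat \<lceil>sqrt (2 * x * real m ^ k)\<rceil> - k" for m
  define p where "p m = freq (J m + k) m (distinct_windows k (J m))" for m
  define s where "s m = sqrt (real m ^ k)" for m
  define c where "c m = real (J m) / s m" for m
  have prob: "measure_pmf.prob (model k m) {(f, w). (real (tau k f w))\<^sup>2 / (2 * real m ^ k) \<ge> x} = p m"
    if "m \<ge> 1" for m
  proof -
    have "(real t)\<^sup>2 / (2 * real m ^ k) \<ge> x \<longleftrightarrow> nat \<lceil>sqrt (2 * x * real m ^ k)\<rceil> \<le> t" for t
    proof -
      have "(real t)\<^sup>2 / (2 * real m ^ k) \<ge> x \<longleftrightarrow> 2 * x * real m ^ k \<le> (real t)\<^sup>2"
        using that by (simp add: field_simps)
      also have "\<dots> \<longleftrightarrow> sqrt (2 * x * real m ^ k) \<le> real t"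
        by (metis of_nat_0_le_iff real_sqrt_le_iff real_sqrt_unique)
      also have "\<dots> \<longleftrightarrow> nat \<lceil>sqrt (2 * x * real m ^ k)\<rceil> \<le> t" by (simp add: nat_le_iff ceiling_le_iff)
      finally show ?thesis .
    qed
    then show ?thesis unfolding p_def J_def using prob_le_tau[OF that assms(1)] by (simp only:)
  qed
  have s: "filterlim s at_top sequentially"
    unfolding s_def[abs_def] using assms
    by (intro filterlim_compose[OF sqrt_at_top] filterlim_pow_at_top filterlim_real_sequentially) auto
  have c: "c \<longlonglongrightarrow> sqrt (2 * x)"
    using tendsto_normalized_time[OF assms] by (simp add: c_def[abs_def] s_def J_def)
  have inv_s: "(\<lambda>m. 1 / s m) \<longlonglongrightarrow> 0"
    using tendsto_divide_0[OF tendsto_const filterlim_at_top_imp_at_infinity[OF s]] .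
  have inv_m: "(\<lambda>m. 1 / real m) \<longlonglongrightarrow> 0" by (rule lim_1_over_n)
  define err where "err m = 2 * real k * c m * (1 / s m) + (2 * real k + 1) * c m ^ 3 * (1 / s m)
      + (real k)\<^sup>2 * (c m)\<^sup>2 * (1 / real m)" for m
  have "err \<longlonglongrightarrow> 2 * real k * sqrt (2 * x) * 0 + (2 * real k + 1) * sqrt (2 * x) ^ 3 * 0
      + (real k)\<^sup>2 * (sqrt (2 * x))\<^sup>2 * 0"
    unfolding err_def by (intro tendsto_intros c inv_s inv_m)
  then have err: "err \<longlonglongrightarrow> 0" by simp
  \<comment> \<open>Rewritten with \<open>J = c * s\<close> and \<open>M = s\<^sup>2\<close>, the bound involves convergent quantities only.\<close>
  have approx: "\<bar>p m - exp (- ((c m)\<^sup>2 / 2 - c m * (1 / s m) / 2))\<bar> \<le> err m" if "m \<ge> 1" for m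
  proof -
    have s0: "s m > 0" using that by (simp add: s_def)
    have M: "real m ^ k = (s m)\<^sup>2" by (simp add: s_def)
    have J: "real (J m) = c m * s m" using s0 by (simp add: c_def)
    have "real (J m) * (real (J m) - 1) / (2 * real m ^ k) = (c m)\<^sup>2 / 2 - c m * (1 / s m) / 2"
      using s0 unfolding M J by (simp add: field_simps power2_eq_square)
    moreover have "real (J m) * (2 * real k / real m ^ k + (2 * real k + 1) * (real (J m))\<^sup>2 / (real m ^ k)\<^sup>2
        + (real k)\<^sup>2 * real (J m) / (real m ^ k * real m)) = err m"
      using s0 that unfolding M J err_def by (simp add: field_simps power2_eq_square power3_eq_cube)
    ultimately show ?thesis
      using freq_distinct_windows_approx[OF that assms(1), of "J m" "J m + k"] by (simp add: p_def)
  qed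
  have "(\<lambda>m. exp (- ((c m)\<^sup>2 / 2 - c m * (1 / s m) / 2)))
      \<longlonglongrightarrow> exp (- ((sqrt (2 * x))\<^sup>2 / 2 - sqrt (2 * x) * 0 / 2))"
    by (intro tendsto_intros c inv_s) auto
  then have lim: "(\<lambda>m. exp (- ((c m)\<^sup>2 / 2 - c m * (1 / s m) / 2))) \<longlonglongrightarrow> exp (- x)"
    using assms by simp
  have "(\<lambda>m. p m - exp (- ((c m)\<^sup>2 / 2 - c m * (1 / s m) / 2))) \<longlonglongrightarrow> 0"
    by (rule Lim_null_comparison[OF _ err])
       (use approx in \<open>auto intro!: eventually_sequentiallyI[of 1]\<close>)
  from tendsto_add[OF this lim] have "p \<longlonglongrightarrow> exp (- x)" by simp
  then show ?thesis
    by (rule Lim_transform_eventually) (use prob in \<open>auto intro!: eventually_sequentiallyI[of 1]\<close>)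
qed

end
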